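(* Let $p$ be a prime, let $K$ be a complete subfield of $\mathbb{C}_p$, let $X$ be equal either to $K[[t]]_{\le M}$ with $M>0$ a real number, or to $K[[t]]_b$, and let $A = \{x\in K : |x|\le1\}$. Then the map $$X\to X,\qquad F\mapsto F'+F$$ is an $A$-module automorphism of $X$. In particular, $F\mapsto F'+F$ is an automorphism of the $A$-module $A[[t]]$. If $G(t) = \sum_{n=0}^\infty b_nt^n\in X$ and $\psi = \sum_{n=0}^\infty n!\,b_n\beta_n$, then the unique $F\in X$ such that $F'+F=G$ is $J_\phi$, where $\phi = \mathscr{S}^{-1}\circ\sigma^{-1}(\psi)$.
   Context: $|\cdot|$ is the absolute value on $\mathbb{C}_p$ with $|p|=1/p$. For real $M>0$, $K[[t]]_{\le M}$ is the set of power series $\sum_{n\ge0}b_nt^n$ with $b_n\in K$ and $|b_n|\le M$ for all $n$, and $K[[t]]_b = \bigcup_{M>0}K[[t]]_{\le M}$ is the set of power series over $K$ with bounded coefficients. $F'$ is the formal derivative. $C(\mathbb{Z}_p,\mathbb{C}_p)$ is the $\mathbb{C}_p$-vector space of continuous functions $\mathbb{Z}_p\to\mathbb{C}_p$; on it $\mathscr{S}$ is the linear automorphism $\mathscr{S}(\phi)(x) = \phi(x)-x\phi(x-1)$ and $\sigma$ is the linear automorphism $\sigma(\phi)(x) = \phi(x+1)$. For $n\ge0$, $\beta_n(x) = \binom{x}{n}$. By Mahler's theorem every $\phi\in C(\mathbb{Z}_p,\mathbb{C}_p)$ can be written uniquely as $\phi = \sum_{n\ge0}n!\,a_n\beta_n$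 with $a_n\in\mathbb{C}_p$ and $n!\,a_n\to0$; then $J_\phi(t) = \sum_{n\ge0}(a_n-a_{n-1})t^n$, where $a_{-1}=0$. *)

theory Defs
  imports
    "HOL-Analysis.Abstract_Metric_Spaces"
    "HOL-Algebra.Algebraic_Closure_Type"
    "HOL-Algebra.Module"
begin

subsection \<open>The field of p-adic complex numbers\<close>

definition abs_dist :: "('c::field \<Rightarrow> real) \<Rightarrow> 'c \<Rightarrow> 'c \<Rightarrow> real"
  where "abs_dist absv x y = absv (x - y)"

definition abs_topology :: "('c::field \<Rightarrow> real) \<Rightarrow> 'c topology"
  where "abs_topology absv = Metric_space.mtopology UNIV (abs_dist absv)"

text \<open>In a complete field of characteristic 0 whose absolute value restricts to the p-adic
  one on the rationals, the closure of the rationals is their completion.\<close>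

definition Q_p :: "('c::field_char_0 \<Rightarrow> real) \<Rightarrow> 'c set"
  where "Q_p absv = abs_topology absv closure_of \<rat>"

definition Z_p :: "('c::field_char_0 \<Rightarrow> real) \<Rightarrow> 'c set"
  where "Z_p absv = {x \<in> Q_p absv. absv x \<le> 1}"

text \<open>The type \<open>'c\<close> with \<open>absv\<close> is (a copy of) the field of p-adic complex numbers: it is
  complete, and it contains an algebraic closure of its subfield of p-adic numbers as a
  dense subset, i.e. it is the completion of an algebraic closure of the p-adic numbers.
  These conditions determine it up to isometric isomorphism: by multiplicativity, the
  ultrametric inequality and the normalisation, \<open>absv\<close> is the p-adic absolute value on the
  rationals, and its extension to the algebraic closure is unique.\<close>

locale padic_complex_field =
  fixes p :: nat and absv :: "'c::field_char_0 \<Rightarrow> real"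
  assumes prime_p: "Factorial_Ring.prime p"
    and absv_nonneg: "0 \<le> absv x"
    and absv_eq_0_iff: "absv x = 0 \<longleftrightarrow> x = 0"
    and absv_mult: "absv (x * y) = absv x * absv y"
    and absv_ultrametric: "absv (x + y) \<le> max (absv x) (absv y)"
    and absv_p: "absv (of_nat p) = 1 / real p"
    and complete: "Metric_space.mcomplete UNIV (abs_dist absv)"
    and dense_algebraic_closure:
      "\<exists>L. algebraic_closure (ring_of_type_algebra\<lparr>carrier := L\<rparr>) (Q_p absv) \<and>
           abs_topology absv closure_of L = UNIV"


subsection \<open>Power series and modules\<close>

definition fps_le :: "('c::field \<Rightarrow> real) \<Rightarrow> 'c set \<Rightarrow> real \<Rightarrow> 'c fps set"
  where "fps_le absv K M = {F. \<forall>n. fps_nth F n \<in> K \<and> absv (fps_nth F n) \<le> M}"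

definition fps_bounded :: "('c::field \<Rightarrow> real) \<Rightarrow> 'c set \<Rightarrow> 'c fps set"
  where "fps_bounded absv K = (\<Union>M\<in>{0<..}. fps_le absv K M)"

definition unit_ball_ring :: "('c::field \<Rightarrow> real) \<Rightarrow> 'c set \<Rightarrow> 'c ring"
  where "unit_ball_ring absv K = ring_of_type_algebra\<lparr>carrier := {x \<in> K. absv x \<le> 1}\<rparr>"

text \<open>The fields \<open>mult\<close> and \<open>one\<close> belong to the record type but are irrelevant for modules.\<close>

definition fps_module :: "'c::field fps set \<Rightarrow> ('c, 'c fps) module"
  where "fps_module W =
    \<lparr>carrier = W, monoid.mult = (*), one = 1, ring.zero = 0, add = (+),
     module.smult = (\<lambda>a F. fps_const a * F)\<rparr>"

definition module_automorphism :: "'r ring \<Rightarrow> ('r, 'm) module \<Rightarrow> ('m \<Rightarrow> 'm) \<Rightarrow> bool"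
  where "module_automorphism R M f \<longleftrightarrow>
    Module.module R M \<and> f \<in> iso (add_monoid M) (add_monoid M) \<and>
    (\<forall>a\<in>carrier R. \<forall>x\<in>carrier M. f (a \<odot>\<^bsub>M\<^esub> x) = a \<odot>\<^bsub>M\<^esub> f x)"


subsection \<open>Continuous functions on the p-adic integers\<close>

text \<open>Functions with domain \<open>Z_p\<close> are represented by extensional functions, so that equality
  in \<open>C_Zp\<close> is equality on \<open>Z_p\<close>.\<close>

definition C_Zp :: "('c::field_char_0 \<Rightarrow> real) \<Rightarrow> ('c \<Rightarrow> 'c) set"
  where "C_Zp absv = {\<phi> \<in> extensional (Z_p absv).
    continuous_map (subtopology (abs_topology absv) (Z_p absv)) (abs_topology absv) \<phi>}"

definition S_op :: "('c::field_char_0 \<Rightarrow> real) \<Rightarrow> ('c \<Rightarrow> 'c) \<Rightarrow> ('c \<Rightarrow> 'c)"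
  where "S_op absv \<phi> = (\<lambda>x\<in>Z_p absv. \<phi> x - x * \<phi> (x - 1))"

definition sigma_op :: "('c::field_char_0 \<Rightarrow> real) \<Rightarrow> ('c \<Rightarrow> 'c) \<Rightarrow> ('c \<Rightarrow> 'c)"
  where "sigma_op absv \<phi> = (\<lambda>x\<in>Z_p absv. \<phi> (x + 1))"

text \<open>\<open>\<phi>\<close> is the sum of the series with terms \<open>c n * (x gchoose n)\<close> in the Banach space
  of continuous functions, i.e. the partial sums converge uniformly.\<close>

definition mahler_sums :: "('c::field_char_0 \<Rightarrow> real) \<Rightarrow> (nat \<Rightarrow> 'c) \<Rightarrow> ('c \<Rightarrow> 'c) \<Rightarrow> bool"
  where "mahler_sums absv c \<phi> \<longleftrightarrow>
    (\<forall>\<epsilon>>0. \<exists>N0. \<forall>N\<ge>N0. \<forall>x\<in>Z_p absv. absv (\<phi> x - (\<Sum>n<N. c n * (x gchoose n))) < \<epsilon>)"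

text \<open>The sequence \<open>a\<close> with \<open>\<phi>\<close> the sum of \<open>n! a n (x gchoose n)\<close>; existence and uniqueness
  for \<open>\<phi> \<in> C_Zp absv\<close> is Mahler's theorem.\<close>

definition mahler_coeff :: "('c::field_char_0 \<Rightarrow> real) \<Rightarrow> ('c \<Rightarrow> 'c) \<Rightarrow> nat \<Rightarrow> 'c"
  where "mahler_coeff absv \<phi> =
    (THE a. (\<lambda>n. absv (fact n * a n)) \<longlonglongrightarrow> 0 \<and> mahler_sums absv (\<lambda>n. fact n * a n) \<phi>)"

definition J_series :: "('c::field_char_0 \<Rightarrow> real) \<Rightarrow> ('c \<Rightarrow> 'c) \<Rightarrow> 'c fps"
  where "J_series absv \<phi> = Abs_fps (\<lambda>n. mahler_coeff absv \<phi> n -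
    (if n = 0 then 0 else mahler_coeff absv \<phi> (n - 1)))"

end

theory Submission
  imports Defs "HOL-Number_Theory.Cong"
begin

text \<open>
  Comparing coefficients, \<open>F' + F = G\<close> reads \<open>(n + 1) f (n + 1) + f n = b n\<close>. Multiplied by
  \<open>n!\<close> and with \<open>u n = n! f n\<close> it becomes \<open>u n + u (n + 1) = n! b n\<close>. The key is that
  \<open>n!\<close> tends to 0 \<open>p\<close>-adically (\<open>absv_fact_tendsto_0\<close>), so that \<open>u\<close> is a null sequence as
  soon as \<open>F\<close> is bounded. If \<open>G = 0\<close>, then \<open>u n\<close> has constant absolute value, so \<open>F = 0\<close>
  (\<open>fps_deriv_add_self_eq_0_imp\<close>). In general, unrolling the recursion to infinity gives
  \<open>f n = (\<Sum>k. (-1)^k (n+k)!/n! b (n+k))\<close>. Here \<open>(n+k)!/n! = k! * ((n+k) choose k)\<close> is an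
  integer divisible by \<open>k!\<close>. So the series converges in the complete field \<open>K\<close> and every
  bound on \<open>G\<close> is inherited by \<open>F\<close> (\<open>fps_deriv_add_self_solvable\<close>).

  For the description by \<open>J\<close>, let \<open>a n = f 0 + \<dots> + f n\<close> and let \<open>\<phi>\<close> be the sum of
  \<open>n! a n \<beta> n\<close>, where \<open>\<beta> n x = x gchoose n\<close>; then \<open>J \<phi> = F\<close> by construction. From
  \<open>x \<beta> n (x - 1) = (n + 1) \<beta> (n + 1) x\<close> it follows that \<open>S \<phi>\<close> is the sum of
  \<open>n! (a n - a (n - 1)) \<beta> n = n! f n \<beta> n\<close>, and Pascal's rule turns \<open>\<sigma> (S \<phi>)\<close> into the sum
  of \<open>(u n + u (n + 1)) \<beta> n = n! b n \<beta> n\<close>, which is \<open>\<psi>\<close>. Since \<open>S\<close> and \<open>\<sigma>\<close> are injective,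
  \<open>\<phi>\<close> is the function obtained from \<open>\<psi>\<close> by the inverse operators
  (\<open>J_series_inverse_operators\<close>).

  These computations with series use that null coefficients give a continuous function and
  are determined by it. This rests on \<open>\<beta> n\<close> having absolute value at most 1 on the
  \<open>p\<close>-adic integers, in which the natural numbers are dense.
\<close>

unbundle no vec_syntax

text \<open>Convergence of a series at a single point, the pointwise counterpart of
  \<open>mahler_sums\<close>.\<close>

definition abs_sums :: "('c::field \<Rightarrow> real) \<Rightarrow> (nat \<Rightarrow> 'c) \<Rightarrow> 'c \<Rightarrow> bool"
  where "abs_sums absv c s \<longleftrightarrow> (\<lambda>N. absv (s - (\<Sum>n<N. c n))) \<longlonglongrightarrow> 0"

section \<open>Ultrametric estimates\<close>

context padic_complex_field
begin

lemma absv_0 [simp]: "absv 0 = 0"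
  using absv_eq_0_iff by blast

lemma absv_1 [simp]: "absv 1 = 1"
  using absv_mult[of 1 1] absv_eq_0_iff[of 1] by simp

lemma absv_minus [simp]: "absv (- x) = absv x"
proof -
  have "absv (-1) * absv (-1) = 1"
    using absv_mult[of "-1" "-1"] by simp
  then have "absv (-1) = 1"
    using absv_nonneg[of "-1"] by (simp add: square_eq_1_iff)
  then show ?thesis
    using absv_mult[of "-1" x] by simp
qed

lemma absv_minus_commute: "absv (x - y) = absv (y - x)"
  using absv_minus[of "x - y"] by simp

lemma absv_add_le: "absv x \<le> B \<Longrightarrow> absv y \<le> B \<Longrightarrow> absv (x + y) \<le> B"
  using absv_ultrametric[of x y] by linarith

lemma absv_diff_le: "absv x \<le> B \<Longrightarrow> absv y \<le> B \<Longrightarrow> absv (x - y) \<le> B"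
  using absv_add_le[of x B "- y"] by simp

lemma absv_add_less: "absv x < B \<Longrightarrow> absv y < B \<Longrightarrow> absv (x + y) < B"
  using absv_ultrametric[of x y] by linarith

lemma absv_diff_less: "absv x < B \<Longrightarrow> absv y < B \<Longrightarrow> absv (x - y) < B"
  using absv_add_less[of x B "- y"] by simp

lemma absv_sum_le:
  assumes "0 \<le> B" "\<And>i. i \<in> I \<Longrightarrow> absv (f i) \<le> B"
  shows "absv (sum f I) \<le> B"
  using assms by (induction I rule: infinite_finite_induct) (auto intro: absv_add_le)

lemma absv_power: "absv (x ^ n) = absv x ^ n"
  by (induction n) (auto simp: absv_mult)

lemma absv_divide: "absv (x / y) = absv x / absv y"
proof (cases "y = 0")
  case False
  then have "absv (x / y) * absv y = absv x"
    using absv_mult[of "x / y" y] by simp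
  then show ?thesis
    using False absv_eq_0_iff[of y] by (simp add: field_simps)
qed simp

lemma absv_prod_le_1:
  assumes "\<And>i. i \<in> I \<Longrightarrow> absv (f i) \<le> 1"
  shows "absv (prod f I) \<le> 1"
  using assms
  by (induction I rule: infinite_finite_induct) (auto simp: absv_mult absv_nonneg mult_le_one)

lemma absv_pos: "x \<noteq> 0 \<Longrightarrow> 0 < absv x"
  using absv_nonneg[of x] absv_eq_0_iff[of x] by linarith

lemma absv_mult_le: "absv x \<le> 1 \<Longrightarrow> absv y \<le> B \<Longrightarrow> absv (x * y) \<le> B"
  using mult_mono[of "absv x" 1 "absv y" B] absv_nonneg by (simp add: absv_mult)

lemma absv_of_nat_le_1: "absv (of_nat n) \<le> 1"
  by (induction n) (auto intro: absv_add_le)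

lemma absv_of_int_le_1: "absv (of_int n) \<le> 1"
  by (cases n rule: int_cases2) (auto simp: absv_of_nat_le_1)

lemma absv_of_nat_dvd_mono: "m dvd n \<Longrightarrow> absv (of_nat n) \<le> absv (of_nat m)"
  by (metis absv_mult_le absv_of_nat_le_1 dvd_def mult.commute of_nat_mult order_refl)

text \<open>An integer prime to \<open>p\<close> is a unit modulo \<open>p\<close>: in a Bezout identity
  \<open>u p + v a = 1\<close> the first term has absolute value below 1, so the second one cannot.\<close>

lemma absv_of_int_coprime:
  assumes "\<not> int p dvd a"
  shows "absv (of_int a) = 1"
proof -
  have "coprime (int p) a"
    using assms prime_p prime_imp_coprime by (metis prime_nat_int_transfer)
  then obtain u v where uv: "u * int p + v * a = 1"
    using bezout_int[of "int p" a] by auto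
  have "1 \<le> max (absv (of_int u * of_nat p)) (absv (of_int v * of_int a))"
    using absv_ultrametric[of "of_int u * of_nat p" "of_int v * of_int a"] uv
    by (metis absv_1 of_int_1 of_int_add of_int_mult of_int_of_nat_eq)
  moreover have "absv (of_int u * of_nat p) \<le> 1 / real p"
    by (intro absv_mult_le absv_of_int_le_1) (simp add: absv_p)
  moreover have "1 / real p < 1"
    using prime_gt_1_nat[OF prime_p] by simp
  moreover have "absv (of_int v * of_int a) \<le> absv (of_int a)"
    using absv_mult_le absv_of_int_le_1 by blast
  ultimately show ?thesis
    using absv_of_int_le_1[of a] by linarith
qed

lemma absv_p_power_tendsto_0: "(\<lambda>k. absv (of_nat (p ^ k))) \<longlonglongrightarrow> 0"
proof -
  have "(\<lambda>k. (1 / real p) ^ k) \<longlonglongrightarrow> 0"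
    using prime_gt_1_nat[OF prime_p] by (intro LIMSEQ_power_zero) simp
  then show ?thesis
    by (simp add: absv_power absv_p)
qed

lemma power_dvd_fact_mult: "p ^ k dvd fact (p * k)"
proof (induction k)
  case (Suc k)
  have p: "p > 0"
    using prime_gt_0_nat[OF prime_p] .
  then obtain j where j: "p * Suc k = Suc j" "p * k \<le> j"
    by (metis (no_types, lifting) Suc_pred add_gr_0 less_Suc_eq_le less_add_same_cancel2 mult_Suc_right)
  have "p * p ^ k dvd Suc j * fact j"
  proof (rule mult_dvd_mono)
    show "p dvd Suc j"
      using j(1) by (metis dvd_triv_left)
    show "p ^ k dvd fact j"
      using Suc fact_dvd[OF j(2)] dvd_trans by blast
  qed
  then show ?case
    by (simp add: j(1) del: mult_Suc_right)
qed simp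

lemma absv_fact_mono: "m \<le> n \<Longrightarrow> absv (fact n) \<le> absv (fact m)"
  using absv_of_nat_dvd_mono[OF fact_dvd] by simp

text \<open>Absolute values of factorials decrease, so bounding them along the multiples of \<open>p\<close>
  suffices; there each step contributes a further factor \<open>p\<close>.\<close>

lemma absv_fact_tendsto_0: "(\<lambda>n. absv (fact n)) \<longlonglongrightarrow> 0"
proof (rule LIMSEQ_I)
  fix e :: real
  assume "e > 0"
  then obtain k where "norm (absv (of_nat (p ^ k)) - 0) < e"
    using LIMSEQ_D[OF absv_p_power_tendsto_0] by blast
  moreover have "absv (fact (p * k)) \<le> absv (of_nat (p ^ k))"
    using absv_of_nat_dvd_mono[OF power_dvd_fact_mult[of k]] by simp
  ultimately have "absv (fact (p * k)) < e"
    by simp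
  then have "norm (absv (fact n) - 0) < e" if "n \<ge> p * k" for n
    using absv_fact_mono[OF that] absv_nonneg[of "fact n"] by simp
  then show "\<exists>n0. \<forall>n\<ge>n0. norm (absv (fact n) - 0) < e"
    by blast
qed

lemma absv_fact_mult_tendsto_0:
  assumes "\<And>n. absv (b n) \<le> M"
  shows "(\<lambda>n. absv (fact n * b n)) \<longlonglongrightarrow> 0"
proof (rule Lim_null_comparison)
  show "(\<lambda>n. absv (fact n) * M) \<longlonglongrightarrow> 0"
    using tendsto_mult_left_zero[OF absv_fact_tendsto_0] .
  show "\<forall>\<^sub>F n in sequentially. norm (absv (fact n * b n)) \<le> absv (fact n) * M"
    using assms by (simp add: absv_mult absv_nonneg mult_left_mono)
qed


section \<open>Convergent series\<close>

lemma Metric_space_abs_dist: "Metric_space S (abs_dist absv)"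
proof
  show "abs_dist absv x z \<le> abs_dist absv x y + abs_dist absv y z" for x y z
    using absv_ultrametric[of "x - y" "y - z"] absv_nonneg[of "x - y"] absv_nonneg[of "y - z"]
    by (simp add: abs_dist_def)
qed (auto simp: abs_dist_def absv_nonneg absv_eq_0_iff absv_minus_commute)

text \<open>In an ultrametric space a series whose terms tend to 0 is already Cauchy. \<open>K\<close> is kept
  general, since convergence is used both in the ambient field and in a complete subfield.\<close>

lemma abs_sums_exists:
  assumes complete_K: "Metric_space.mcomplete K (abs_dist absv)"
    and K_0: "0 \<in> K" and K_add: "\<And>x y. x \<in> K \<Longrightarrow> y \<in> K \<Longrightarrow> x + y \<in> K"
    and c: "\<And>n. c n \<in> K" "(\<lambda>n. absv (c n)) \<longlonglongrightarrow> 0"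
  shows "\<exists>s\<in>K. abs_sums absv c s"
proof -
  interpret Metric_space K "abs_dist absv"
    by (rule Metric_space_abs_dist)
  define \<sigma> where "\<sigma> N = (\<Sum>n<N. c n)" for N
  have "\<sigma> N \<in> K" for N
    unfolding \<sigma>_def by (induction N) (auto simp: K_0 K_add c)
  moreover have "\<exists>N. \<forall>m n. N \<le> m \<longrightarrow> N \<le> n \<longrightarrow> abs_dist absv (\<sigma> m) (\<sigma> n) < e" if "e > 0" for e
  proof -
    obtain N where N: "\<And>n. n \<ge> N \<Longrightarrow> absv (c n) < e / 2"
      using LIMSEQ_D[OF c(2), of "e / 2"] \<open>e > 0\<close> by (auto simp: absv_nonneg)
    have "absv (\<sigma> n - \<sigma> N) \<le> e / 2" if "N \<le> n" for n
    proof -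
      have "\<sigma> n - \<sigma> N = sum c {N..<n}"
        using sum_diff_nat_ivl[of 0 N n c] that by (simp add: \<sigma>_def lessThan_atLeast0)
      moreover have "absv (sum c {N..<n}) \<le> e / 2"
        using N \<open>e > 0\<close> less_imp_le by (intro absv_sum_le) fastforce+
      ultimately show ?thesis
        by simp
    qed
    then have "absv ((\<sigma> m - \<sigma> N) - (\<sigma> n - \<sigma> N)) \<le> e / 2" if "N \<le> m" "N \<le> n" for m n
      using absv_diff_le that by blast
    moreover have "e / 2 < e"
      using \<open>e > 0\<close> by simp
    ultimately show ?thesis
      unfolding abs_dist_def by (metis diff_diff_eq2 diff_add_cancel le_less_trans)
  qed
  ultimately have "MCauchy \<sigma>"
    unfolding MCauchy_def by blast
  then obtain s where "limitin mtopology \<sigma> s sequentially"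
    using complete_K by (auto simp: mcomplete_def)
  then have "s \<in> K" and s: "(\<lambda>N. abs_dist absv (\<sigma> N) s) \<longlonglongrightarrow> 0"
    unfolding limitin_metric_dist_null by blast+
  have "abs_sums absv c s"
    using s unfolding abs_sums_def abs_dist_def \<sigma>_def by (subst absv_minus_commute)
  with \<open>s \<in> K\<close> show ?thesis
    by blast
qed

text \<open>The ultrametric inequality survives the limit. For \<open>N = 0\<close> this bounds the sum
  itself; for large \<open>N\<close> it gives an error term depending on the coefficients only, hence
  uniform convergence.\<close>

lemma abs_sums_tail_le:
  assumes "abs_sums absv c s" "0 \<le> B" "\<And>n. n \<ge> N \<Longrightarrow> absv (c n) \<le> B"
  shows "absv (s - (\<Sum>n<N. c n)) \<le> B"
proof (rule field_le_epsilon)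
  fix e :: real
  assume "e > 0"
  then obtain N1 where N1: "\<And>n. n \<ge> N1 \<Longrightarrow> absv (s - (\<Sum>i<n. c i)) < e"
    using assms(1) LIMSEQ_D[of "\<lambda>N. absv (s - (\<Sum>n<N. c n))" 0 e]
    unfolding abs_sums_def by (auto simp: absv_nonneg)
  define n where "n = max N N1"
  have "(\<Sum>i<n. c i) - (\<Sum>i<N. c i) = sum c {N..<n}"
    using sum_diff_nat_ivl[of 0 N n c] by (simp add: n_def lessThan_atLeast0)
  then have "absv ((\<Sum>i<n. c i) - (\<Sum>i<N. c i)) \<le> B"
    using assms by (auto intro!: absv_sum_le)
  moreover have "absv (s - (\<Sum>i<n. c i)) < e"
    by (rule N1) (simp add: n_def)
  ultimately have "absv ((s - (\<Sum>i<n. c i)) + ((\<Sum>i<n. c i) - (\<Sum>i<N. c i))) \<le> B + e"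
    using \<open>e > 0\<close> \<open>0 \<le> B\<close> by (intro absv_add_le) auto
  then show "absv (s - (\<Sum>n<N. c n)) \<le> B + e"
    by simp
qed

lemma abs_sums_add:
  assumes "abs_sums absv c s" "abs_sums absv d t"
  shows "abs_sums absv (\<lambda>n. c n + d n) (s + t)"
  unfolding abs_sums_def
proof (rule Lim_null_comparison)
  show "(\<lambda>N. absv (s - (\<Sum>n<N. c n)) + absv (t - (\<Sum>n<N. d n))) \<longlonglongrightarrow> 0"
    using tendsto_add[of _ 0 _ _ 0] assms unfolding abs_sums_def by fastforce
  have "absv (s + t - (\<Sum>n<N. c n + d n)) \<le> absv (s - (\<Sum>n<N. c n)) + absv (t - (\<Sum>n<N. d n))" for N
    using absv_ultrametric[of "s - (\<Sum>n<N. c n)" "t - (\<Sum>n<N. d n)"]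
      absv_nonneg[of "s - (\<Sum>n<N. c n)"] absv_nonneg[of "t - (\<Sum>n<N. d n)"]
    by (simp add: sum.distrib algebra_simps)
  then show "\<forall>\<^sub>F N in sequentially. norm (absv (s + t - (\<Sum>n<N. c n + d n)))
      \<le> absv (s - (\<Sum>n<N. c n)) + absv (t - (\<Sum>n<N. d n))"
    by (simp add: absv_nonneg)
qed

lemma abs_sums_mult:
  assumes "abs_sums absv c s"
  shows "abs_sums absv (\<lambda>n. a * c n) (a * s)"
proof -
  have "(\<lambda>N. absv a * absv (s - (\<Sum>n<N. c n))) \<longlonglongrightarrow> 0"
    using assms tendsto_mult_right_zero unfolding abs_sums_def by blast
  then show ?thesis
    by (simp add: abs_sums_def absv_mult[symmetric] right_diff_distrib sum_distrib_left)
qed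

lemma abs_sums_diff:
  assumes "abs_sums absv c s" "abs_sums absv d t"
  shows "abs_sums absv (\<lambda>n. c n - d n) (s - t)"
  using abs_sums_add[OF assms(1) abs_sums_mult[OF assms(2), of "-1"]] by simp

lemma abs_sums_Suc_imp:
  assumes "abs_sums absv (\<lambda>n. c (Suc n)) s"
  shows "abs_sums absv c (c 0 + s)"
  using assms unfolding abs_sums_def
  by (intro LIMSEQ_imp_Suc[of "\<lambda>N. absv (c 0 + s - (\<Sum>n<N. c n))"])
     (simp add: sum.lessThan_Suc_shift del: sum.lessThan_Suc)

lemma abs_sums_unique:
  assumes "abs_sums absv c s" "abs_sums absv c t"
  shows "s = t"
proof -
  have "abs_sums absv (\<lambda>n. 0) (s - t)"
    using abs_sums_diff[OF assms] by simp
  then have "absv (s - t) = 0"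
    by (simp add: abs_sums_def LIMSEQ_const_iff)
  then show ?thesis
    by (simp add: absv_eq_0_iff)
qed

section \<open>Binomial polynomials on the p-adic integers\<close>

lemma Q_p_iff: "x \<in> Q_p absv \<longleftrightarrow> (\<forall>e>0. \<exists>q\<in>\<rat>. absv (x - q) < e)"
proof -
  interpret Metric_space UNIV "abs_dist absv"
    by (rule Metric_space_abs_dist)
  show ?thesis
    by (simp add: Q_p_def abs_topology_def metric_closure_of abs_dist_def)
qed

text \<open>If \<open>a / b\<close> is a reduced fraction of absolute value at most 1, then \<open>p\<close> does not divide
  \<open>b\<close>. So \<open>b\<close> is invertible modulo every \<open>p ^ k\<close> and a natural number congruent to
  \<open>a * b'\<close> modulo \<open>p ^ k\<close>, with \<open>b'\<close> such an inverse, is close to the fraction.\<close>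

lemma rational_approx_nat:
  assumes "q \<in> \<rat>" "absv q \<le> 1" "e > 0"
  shows "\<exists>m. absv (q - of_nat m) < e"
proof -
  obtain r where r: "q = of_rat r"
    using assms(1) by (auto elim: Rats_cases)
  obtain a b where ab: "r = Rat.Fract a b" "b > 0" "coprime a b"
    by (cases r)
  have q: "q = of_int a / of_int b"
    using ab r by (simp add: of_rat_rat)
  have b: "\<not> int p dvd b"
  proof
    assume pb: "int p dvd b"
    have "\<not> int p dvd a"
      using pb ab(3) prime_p coprime_common_divisor_int[of a b "int p"] prime_gt_1_nat[OF prime_p]
      by (meson coprime_common_divisor not_prime_unit prime_nat_int_transfer)
    then have "absv (of_int a) = 1"
      by (rule absv_of_int_coprime)
    moreover obtain k where "b = int p * k"
      using pb by blast
    then have "absv (of_int b) \<le> 1 / real p"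
      using absv_mult_le[of "of_int k" "of_nat p" "1 / real p"] absv_of_int_le_1[of k] absv_p
      by (simp add: mult.commute)
    moreover have "1 / real p < 1"
      using prime_gt_1_nat[OF prime_p] by simp
    moreover have "absv (of_int b) > 0"
      using ab(2) by (simp add: absv_pos)
    ultimately show False
      using assms(2) unfolding q absv_divide by (simp add: field_simps)
  qed
  obtain k where k: "absv (of_nat (p ^ k)) < e"
    using LIMSEQ_D[OF absv_p_power_tendsto_0 assms(3)] by (auto simp: absv_nonneg)
  have "coprime b (int p ^ k)"
    using b prime_p prime_imp_coprime
    by (metis coprime_commute coprime_power_right_iff prime_nat_int_transfer)
  then obtain b' where b': "[b * b' = 1] (mod int p ^ k)"
    using cong_solve_coprime_int by blast
  define m where "m = nat ((a * b') mod int p ^ k)"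
  have m: "int m = (a * b') mod int p ^ k"
    using prime_gt_0_nat[OF prime_p] by (simp add: m_def)
  have "[b * int m = b * (a * b')] (mod int p ^ k)"
    unfolding m by (simp add: cong_def mod_mult_right_eq)
  also have "b * (a * b') = a * (b * b')"
    by (simp add: algebra_simps)
  also have "[a * (b * b') = a * 1] (mod int p ^ k)"
    using b' cong_scalar_left by blast
  finally have "int p ^ k dvd a - b * int m"
    by (simp add: cong_iff_dvd_diff dvd_diff_commute)
  then obtain l where l: "a - b * int m = int p ^ k * l" ..
  have "absv (of_int (a - b * int m)) \<le> absv (of_nat (p ^ k))"
    using absv_mult_le[of "of_int l" "of_nat (p ^ k)"] absv_of_int_le_1[of l]
    unfolding l by (simp add: mult.commute)
  moreover have "q - of_nat m = of_int (a - b * int m) / of_int b"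
    using ab(2) by (simp add: q field_simps)
  ultimately show ?thesis
    using absv_of_int_coprime[OF b] k by (auto simp: absv_divide intro!: exI[of _ m])
qed

lemma Z_p_approx_nat:
  assumes "x \<in> Z_p absv" "e > 0"
  shows "\<exists>m. absv (x - of_nat m) < e"
proof -
  have "x \<in> Q_p absv" "0 < min e 1"
    using assms by (auto simp: Z_p_def)
  then obtain q where q: "q \<in> \<rat>" "absv (x - q) < min e 1"
    unfolding Q_p_iff by blast
  have "absv (x - (x - q)) \<le> 1"
    using absv_diff_le[of x 1 "x - q"] q(2) assms(1) by (auto simp: Z_p_def)
  then obtain m where "absv (q - of_nat m) < e"
    using rational_approx_nat[OF q(1) _ assms(2)] by auto
  then have "absv ((x - q) + (q - of_nat m)) < e"
    using q(2) by (intro absv_add_less) auto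
  then have "absv (x - of_nat m) < e"
    by simp
  then show ?thesis ..
qed

lemma of_nat_Z_p: "of_nat n \<in> Z_p absv"
proof -
  have "absv (of_nat n - of_nat n) < e" if "e > 0" for e
    using that by simp
  then show ?thesis
    using absv_of_nat_le_1 Rats_of_nat unfolding Z_p_def Q_p_iff by blast
qed

lemma Z_p_add:
  assumes "x \<in> Z_p absv" "y \<in> Z_p absv"
  shows "x + y \<in> Z_p absv"
proof -
  have "\<exists>q\<in>\<rat>. absv (x + y - q) < e" if e: "e > 0" for e
  proof -
    obtain m n where "absv (x - of_nat m) < e" "absv (y - of_nat n) < e"
      using assms e Z_p_approx_nat by blast
    then have "absv ((x - of_nat m) + (y - of_nat n)) < e"
      by (rule absv_add_less)
    then have "absv (x + y - of_nat (m + n)) < e"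
      by (simp add: algebra_simps)
    then show ?thesis
      using Rats_of_nat by blast
  qed
  then show ?thesis
    using assms by (auto simp: Z_p_def Q_p_iff absv_add_le)
qed

lemma Z_p_minus:
  assumes "x \<in> Z_p absv"
  shows "- x \<in> Z_p absv"
proof -
  have "\<exists>q\<in>\<rat>. absv (- x - q) < e" if e: "e > 0" for e
  proof -
    obtain m where m: "absv (x - of_nat m) < e"
      using assms e Z_p_approx_nat by blast
    show ?thesis
      by (rule bexI[of _ "- of_nat m"])
        (use m absv_minus_commute[of x "of_nat m"] in auto)
  qed
  then show ?thesis
    using assms by (auto simp: Z_p_def Q_p_iff)
qed

lemma Z_p_diff: "x \<in> Z_p absv \<Longrightarrow> y \<in> Z_p absv \<Longrightarrow> x - y \<in> Z_p absv"
  using Z_p_add[of x "- y"] Z_p_minus by simp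

lemma Z_p_1: "1 \<in> Z_p absv"
  using of_nat_Z_p[of 1] by simp

text \<open>The factor \<open>h\<close> of the numerator \<open>h (h - 1) \<dots>\<close> is kept, the others are at most 1. The
  bound is crude, but it is small for \<open>h\<close> close to 0.\<close>

lemma absv_gbinomial_le_divide_fact:
  assumes "absv h \<le> 1" "0 < k"
  shows "absv (h gchoose k) \<le> absv h / absv (fact k)"
proof -
  obtain j where k: "k = Suc j"
    using assms(2) by (cases k) auto
  have "absv (\<Prod>i=0..<j. h - of_nat (Suc i)) \<le> 1"
    using assms(1) absv_of_nat_le_1 by (intro absv_prod_le_1 absv_diff_le) (auto simp del: of_nat_Suc)
  then have "absv ((\<Prod>i=0..<j. h - of_nat (Suc i)) * h) \<le> absv h"
    by (intro absv_mult_le) auto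
  then have "absv (\<Prod>i=0..<k. h - of_nat i) \<le> absv h"
    by (simp add: k prod.atLeast0_lessThan_Suc_shift mult.commute
        del: prod.op_ivl_Suc of_nat_Suc)
  then show ?thesis
    by (simp add: gbinomial_prod_rev absv_divide divide_right_mono absv_nonneg)
qed

text \<open>Vandermonde's identity expands \<open>y + h gchoose n\<close> in the binomials of \<open>h\<close>, and
  subtracting the \<open>k = 0\<close> term leaves only terms with a factor \<open>h\<close>. The bound on the
  binomials of \<open>y\<close> is a hypothesis because the lemma is first applied to natural numbers \<open>y\<close>,
  in order to prove that bound for all \<open>p\<close>-adic integers.\<close>

lemma absv_gbinomial_add_diff_le:
  assumes y: "\<And>k. absv (y gchoose k) \<le> 1" and h: "absv h \<le> 1"
  shows "absv ((y + h gchoose n) - (y gchoose n)) \<le> absv h / absv (fact n)"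
proof -
  have "(y + h gchoose n) = (\<Sum>k=0..n. (h gchoose k) * (y gchoose (n - k)))"
    by (simp add: gbinomial_Vandermonde add.commute)
  also have "\<dots> = (y gchoose n) + (\<Sum>k\<in>{0<..n}. (h gchoose k) * (y gchoose (n - k)))"
    by (simp add: sum.head)
  finally have eq: "(y + h gchoose n) - (y gchoose n)
      = (\<Sum>k\<in>{0<..n}. (y gchoose (n - k)) * (h gchoose k))"
    by (simp add: mult.commute)
  show ?thesis
    unfolding eq
  proof (rule absv_sum_le)
    show "0 \<le> absv h / absv (fact n)"
      by (simp add: absv_nonneg)
    fix k
    assume k: "k \<in> {0<..n}"
    have "absv (h gchoose k) \<le> absv h / absv (fact k)"
      using absv_gbinomial_le_divide_fact[OF h] k by simp
    also have "\<dots> \<le> absv h / absv (fact n)"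
      using k by (intro divide_left_mono mult_pos_pos absv_fact_mono) (auto simp: absv_nonneg absv_pos)
    finally show "absv ((y gchoose (n - k)) * (h gchoose k)) \<le> absv h / absv (fact n)"
      by (rule absv_mult_le[OF y])
  qed
qed

lemma absv_gbinomial_of_nat_le_1: "absv (of_nat m gchoose n) \<le> 1"
  using absv_of_nat_le_1[of "m choose n"] by (simp add: binomial_gbinomial)

text \<open>The binomial of a natural number is an integer. A \<open>p\<close>-adic integer is close enough to a
  natural number for the two binomials to differ by at most 1.\<close>

lemma absv_gbinomial_le_1:
  assumes "x \<in> Z_p absv"
  shows "absv (x gchoose n) \<le> 1"
proof -
  have "absv (fact n) > 0"
    by (simp add: absv_pos)
  then obtain m where m: "absv (x - of_nat m) < min 1 (absv (fact n))"
    using Z_p_approx_nat[OF assms, of "min 1 (absv (fact n))"] by auto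
  have "absv ((of_nat m + (x - of_nat m) gchoose n) - (of_nat m gchoose n))
      \<le> absv (x - of_nat m) / absv (fact n)"
    using m by (intro absv_gbinomial_add_diff_le absv_gbinomial_of_nat_le_1) auto
  also have "\<dots> \<le> 1"
    using m \<open>absv (fact n) > 0\<close> by simp
  finally have "absv (((x gchoose n) - (of_nat m gchoose n)) + (of_nat m gchoose n)) \<le> 1"
    using absv_gbinomial_of_nat_le_1 by (intro absv_add_le) auto
  then show ?thesis
    by simp
qed

lemma absv_gbinomial_diff_le:
  assumes "x \<in> Z_p absv" "y \<in> Z_p absv"
  shows "absv ((x gchoose n) - (y gchoose n)) \<le> absv (x - y) / absv (fact n)"
  using absv_gbinomial_add_diff_le[of y "x - y" n] absv_gbinomial_le_1[OF assms(2)]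
    Z_p_diff[OF assms] by (simp add: Z_p_def)


section \<open>Mahler series\<close>

text \<open>Uniform convergence comes for free, because the tails are bounded by the coefficients
  alone. All later identities between Mahler series can therefore be checked pointwise.\<close>

lemma mahler_sums_iff_abs_sums:
  assumes c: "(\<lambda>n. absv (c n)) \<longlonglongrightarrow> 0"
  shows "mahler_sums absv c \<phi> \<longleftrightarrow>
    (\<forall>x\<in>Z_p absv. abs_sums absv (\<lambda>n. c n * (x gchoose n)) (\<phi> x))"
proof
  assume "mahler_sums absv c \<phi>"
  then show "\<forall>x\<in>Z_p absv. abs_sums absv (\<lambda>n. c n * (x gchoose n)) (\<phi> x)"
    unfolding mahler_sums_def abs_sums_def LIMSEQ_iff by (simp add: absv_nonneg) blast
next
  assume sums: "\<forall>x\<in>Z_p absv. abs_sums absv (\<lambda>n. c n * (x gchoose n)) (\<phi> x)"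
  show "mahler_sums absv c \<phi>"
    unfolding mahler_sums_def
  proof (intro allI impI)
    fix e :: real
    assume e: "e > 0"
    have "\<forall>\<^sub>F n in sequentially. absv (c n) < e / 2"
      using order_tendstoD(2)[OF c, of "e / 2"] e by simp
    then obtain N0 where N0: "\<And>n. n \<ge> N0 \<Longrightarrow> absv (c n) < e / 2"
      by (auto simp: eventually_sequentially)
    have "absv (\<phi> x - (\<Sum>n<N. c n * (x gchoose n))) < e" if N: "N \<ge> N0" and x: "x \<in> Z_p absv" for N x
    proof -
      have "absv (c n * (x gchoose n)) \<le> e / 2" if "n \<ge> N" for n
        using absv_mult_le[OF absv_gbinomial_le_1[OF x], of "c n" "e / 2" n] N0[of n] N that
        by (simp add: mult.commute)
      then have "absv (\<phi> x - (\<Sum>n<N. c n * (x gchoose n))) \<le> e / 2"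
        using sums x e by (intro abs_sums_tail_le) auto
      then show ?thesis
        using e by simp
    qed
    then show "\<exists>N0. \<forall>N\<ge>N0. \<forall>x\<in>Z_p absv. absv (\<phi> x - (\<Sum>n<N. c n * (x gchoose n))) < e"
      by blast
  qed
qed

lemma Z_p_abs_sums_exists:
  assumes c: "(\<lambda>n. absv (c n)) \<longlonglongrightarrow> 0" and x: "x \<in> Z_p absv"
  shows "\<exists>s. abs_sums absv (\<lambda>n. c n * (x gchoose n)) s"
proof -
  have le: "absv (c n * (x gchoose n)) \<le> absv (c n)" for n
    using absv_mult_le[OF absv_gbinomial_le_1[OF x] order_refl] by (simp add: mult.commute)
  have "(\<lambda>n. absv (c n * (x gchoose n))) \<longlonglongrightarrow> 0"
    by (rule Lim_null_comparison[OF _ c]) (simp add: absv_nonneg le)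
  then show ?thesis
    using abs_sums_exists[OF complete, of "\<lambda>n. c n * (x gchoose n)"] by blast
qed

lemma C_Zp_iff:
  "\<phi> \<in> C_Zp absv \<longleftrightarrow> \<phi> \<in> extensional (Z_p absv) \<and>
    (\<forall>x\<in>Z_p absv. \<forall>e>0. \<exists>d>0. \<forall>y. y \<in> Z_p absv \<and> absv (x - y) < d \<longrightarrow> absv (\<phi> x - \<phi> y) < e)"
proof -
  interpret Submetric UNIV "abs_dist absv" "Z_p absv"
    by (intro Submetric.intro Metric_space_abs_dist Submetric_axioms.intro) simp
  have "continuous_map (subtopology (abs_topology absv) (Z_p absv)) (abs_topology absv) \<phi> \<longleftrightarrow>
      continuous_map sub.mtopology mtopology \<phi>"
    by (simp add: abs_topology_def mtopology_submetric)
  also have "\<dots> \<longleftrightarrow> (\<forall>x\<in>Z_p absv. \<forall>e>0. \<exists>d>0. \<forall>y. y \<in> Z_p absv \<and> absv (x - y) < d \<longrightarrow>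
      absv (\<phi> x - \<phi> y) < e)"
    by (simp add: sub.metric_continuous_map[OF Metric_space_abs_dist] abs_dist_def)
  finally show ?thesis
    by (simp add: C_Zp_def)
qed

text \<open>The sum is uniformly close to a partial sum, whose terms are Lipschitz by
  \<open>absv_gbinomial_diff_le\<close>; this makes the sum uniformly continuous.\<close>

lemma mahler_sums_continuous:
  assumes c: "(\<lambda>n. absv (c n)) \<longlonglongrightarrow> 0"
    and sums: "\<And>x. x \<in> Z_p absv \<Longrightarrow> abs_sums absv (\<lambda>n. c n * (x gchoose n)) (\<phi> x)"
    and "e > 0"
  shows "\<exists>d>0. \<forall>x\<in>Z_p absv. \<forall>y\<in>Z_p absv. absv (x - y) < d \<longrightarrow> absv (\<phi> x - \<phi> y) < e"
proof -
  have "mahler_sums absv c \<phi>"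
    using sums by (simp add: mahler_sums_iff_abs_sums[OF c])
  then obtain N where N: "\<And>x. x \<in> Z_p absv \<Longrightarrow> absv (\<phi> x - (\<Sum>n<N. c n * (x gchoose n))) < e"
    using \<open>e > 0\<close> unfolding mahler_sums_def by blast
  obtain C where C: "\<And>n. absv (c n) \<le> C"
    using convergent_imp_Bseq[OF convergentI[OF c]] by (auto simp: Bseq_def absv_nonneg)
  have "C \<ge> 0"
    using C[of 0] absv_nonneg[of "c 0"] by linarith
  have fact_pos: "absv (fact n) > 0" for n
    by (simp add: absv_pos)
  \<comment> \<open>\<open>1 / absv (fact N)\<close> is a common Lipschitz constant of the first \<open>N\<close> binomials and \<open>C\<close>
    bounds the coefficients; \<open>C + 1\<close> avoids division by 0.\<close>
  define d where "d = e * absv (fact N) / (C + 1)"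
  have d: "d > 0" "C * (d / absv (fact N)) < e"
  proof -
    show "d > 0"
      using \<open>e > 0\<close> \<open>C \<ge> 0\<close> fact_pos by (simp add: d_def)
    have "C * (d / absv (fact N)) = e * (C / (C + 1))"
      using fact_pos[of N] by (simp add: d_def)
    also have "\<dots> < e * 1"
      using \<open>e > 0\<close> \<open>C \<ge> 0\<close> by (intro mult_strict_left_mono) auto
    finally show "C * (d / absv (fact N)) < e"
      by simp
  qed
  have "absv (\<phi> x - \<phi> y) < e"
    if x: "x \<in> Z_p absv" and y: "y \<in> Z_p absv" and xy: "absv (x - y) < d" for x y
  proof -
    have partial: "absv ((\<Sum>n<N. c n * (x gchoose n)) - (\<Sum>n<N. c n * (y gchoose n))) \<le> C * (d / absv (fact N))"
      unfolding sum_subtractf[symmetric]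
    proof (rule absv_sum_le)
      show "0 \<le> C * (d / absv (fact N))"
        using d(1) \<open>C \<ge> 0\<close> fact_pos[of N] by simp
      fix n
      assume n: "n \<in> {..<N}"
      have "absv ((x gchoose n) - (y gchoose n)) \<le> absv (x - y) / absv (fact n)"
        by (rule absv_gbinomial_diff_le[OF x y])
      also have "\<dots> \<le> d / absv (fact N)"
        using n xy d(1) fact_pos by (intro frac_le absv_fact_mono) auto
      finally have "absv (c n * ((x gchoose n) - (y gchoose n))) \<le> C * (d / absv (fact N))"
        unfolding absv_mult using C[of n] \<open>C \<ge> 0\<close> by (intro mult_mono) (auto simp: absv_nonneg)
      then show "absv (c n * (x gchoose n) - c n * (y gchoose n)) \<le> C * (d / absv (fact N))"
        by (simp add: right_diff_distrib)
    qed
    show ?thesis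
      using absv_diff_less[OF absv_add_less[OF N[OF x] le_less_trans[OF partial d(2)]] N[OF y]]
      by simp
  qed
  then show ?thesis
    using d(1) by blast
qed

lemma mahler_sums_exists:
  assumes c: "(\<lambda>n. absv (c n)) \<longlonglongrightarrow> 0"
  shows "\<exists>\<phi>\<in>C_Zp absv. mahler_sums absv c \<phi>"
proof -
  obtain \<phi>0 where \<phi>0: "\<And>x. x \<in> Z_p absv \<Longrightarrow> abs_sums absv (\<lambda>n. c n * (x gchoose n)) (\<phi>0 x)"
    using Z_p_abs_sums_exists[OF c] by metis
  define \<phi> where "\<phi> = restrict \<phi>0 (Z_p absv)"
  have \<phi>: "\<And>x. x \<in> Z_p absv \<Longrightarrow> abs_sums absv (\<lambda>n. c n * (x gchoose n)) (\<phi> x)"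
    by (simp add: \<phi>_def \<phi>0)
  have "\<phi> \<in> C_Zp absv"
    using mahler_sums_continuous[OF c \<phi>] by (auto simp: C_Zp_iff \<phi>_def) metis
  moreover have "mahler_sums absv c \<phi>"
    using \<phi> by (simp add: mahler_sums_iff_abs_sums[OF c])
  ultimately show ?thesis
    by blast
qed

lemma mahler_sums_unique:
  assumes c: "(\<lambda>n. absv (c n)) \<longlonglongrightarrow> 0"
    and "mahler_sums absv c \<phi>" "mahler_sums absv c \<psi>"
    and "\<phi> \<in> extensional (Z_p absv)" "\<psi> \<in> extensional (Z_p absv)"
  shows "\<phi> = \<psi>"
  using assms(2,3) abs_sums_unique unfolding mahler_sums_iff_abs_sums[OF c]
  by (intro extensionalityI[OF assms(4,5)]) blast

text \<open>At the natural number \<open>m\<close> the series stops after the term \<open>c m\<close>, whose binomial is 1,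
  so its value determines \<open>c m\<close> once the earlier coefficients are known.\<close>

lemma mahler_coefficients_unique:
  assumes "(\<lambda>n. absv (c n)) \<longlonglongrightarrow> 0" "(\<lambda>n. absv (d n)) \<longlonglongrightarrow> 0"
    and "mahler_sums absv c \<phi>" "mahler_sums absv d \<phi>"
  shows "c = d"
proof
  fix m
  show "c m = d m"
  proof (induction m rule: less_induct)
    case (less m)
    define x :: 'c where "x = of_nat m"
    have x: "x \<in> Z_p absv"
      by (simp add: x_def of_nat_Z_p)
    have "abs_sums absv (\<lambda>n. c n * (x gchoose n)) (\<phi> x)" "abs_sums absv (\<lambda>n. d n * (x gchoose n)) (\<phi> x)"
      using assms x by (auto simp: mahler_sums_iff_abs_sums)
    then have "abs_sums absv (\<lambda>n. c n * (x gchoose n) - d n * (x gchoose n)) 0"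
      using abs_sums_diff by fastforce
    then have "absv (0 - (\<Sum>n<Suc m. c n * (x gchoose n) - d n * (x gchoose n))) \<le> 0"
    proof (rule abs_sums_tail_le)
      fix n
      assume "n \<ge> Suc m"
      then have "x gchoose n = 0"
        unfolding x_def binomial_gbinomial[symmetric] by (simp add: binomial_eq_0)
      then show "absv (c n * (x gchoose n) - d n * (x gchoose n)) \<le> 0"
        by simp
    qed simp
    moreover have "x gchoose m = 1"
      unfolding x_def binomial_gbinomial[symmetric] by simp
    ultimately have "absv (d m - c m) \<le> 0"
      using less by simp
    then show "c m = d m"
      using absv_pos[of "d m - c m"] by force
  qed
qed

lemma mahler_coeff_eqI:
  assumes "(\<lambda>n. absv (fact n * a n)) \<longlonglongrightarrow> 0" "mahler_sums absv (\<lambda>n. fact n * a n) \<phi>"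
  shows "mahler_coeff absv \<phi> = a"
  unfolding mahler_coeff_def
proof (rule the_equality)
  fix b
  assume "(\<lambda>n. absv (fact n * b n)) \<longlonglongrightarrow> 0 \<and> mahler_sums absv (\<lambda>n. fact n * b n) \<phi>"
  then have "(\<lambda>n. fact n * b n) = (\<lambda>n. fact n * a n)"
    using mahler_coefficients_unique[of "\<lambda>n. fact n * b n" "\<lambda>n. fact n * a n" \<phi>] assms by blast
  then show "b = a"
    by (auto simp: fun_eq_iff)
qed (use assms in blast)


section \<open>The operators \<open>S\<close> and \<open>\<sigma>\<close>\<close>

lemma inj_on_sigma_op: "inj_on (sigma_op absv) (C_Zp absv)"
proof (rule inj_onI)
  fix \<phi> \<psi>
  assume \<phi>: "\<phi> \<in> C_Zp absv" and \<psi>: "\<psi> \<in> C_Zp absv" and eq: "sigma_op absv \<phi> = sigma_op absv \<psi>"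
  show "\<phi> = \<psi>"
  proof (rule extensionalityI)
    fix x
    assume "x \<in> Z_p absv"
    then have "x - 1 \<in> Z_p absv"
      by (simp add: Z_p_diff Z_p_1)
    then show "\<phi> x = \<psi> x"
      using fun_cong[OF eq, of "x - 1"] by (simp add: sigma_op_def)
  qed (use \<phi> \<psi> in \<open>auto simp: C_Zp_def\<close>)
qed

text \<open>\<open>S \<phi>\<close> determines \<open>\<phi> 0\<close> (the factor \<open>x\<close> vanishes there) and then \<open>\<phi> m\<close> from
  \<open>\<phi> (m - 1)\<close>; continuity extends this from the natural numbers to their closure.\<close>

lemma inj_on_S_op: "inj_on (S_op absv) (C_Zp absv)"
proof (rule inj_onI)
  fix \<phi> \<psi>
  assume \<phi>: "\<phi> \<in> C_Zp absv" and \<psi>: "\<psi> \<in> C_Zp absv" and eq: "S_op absv \<phi> = S_op absv \<psi>"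
  have S: "\<phi> x - x * \<phi> (x - 1) = \<psi> x - x * \<psi> (x - 1)" if "x \<in> Z_p absv" for x
    using fun_cong[OF eq, of x] that by (simp add: S_op_def)
  have nat: "\<phi> (of_nat m) = \<psi> (of_nat m)" for m
  proof (induction m)
    case 0
    then show ?case
      using S[OF of_nat_Z_p[of 0]] by simp
  next
    case (Suc m)
    then show ?case
      using S[OF of_nat_Z_p[of "Suc m"]] by simp
  qed
  show "\<phi> = \<psi>"
  proof (rule extensionalityI)
    fix x
    assume x: "x \<in> Z_p absv"
    have "absv (\<phi> x - \<psi> x) \<le> 0 + e" if "e > 0" for e
    proof -
      obtain d1 where d1: "d1 > 0" "\<And>y. y \<in> Z_p absv \<Longrightarrow> absv (x - y) < d1 \<Longrightarrow> absv (\<phi> x - \<phi> y) < e"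
        using \<phi> x \<open>e > 0\<close> unfolding C_Zp_iff by meson
      obtain d2 where d2: "d2 > 0" "\<And>y. y \<in> Z_p absv \<Longrightarrow> absv (x - y) < d2 \<Longrightarrow> absv (\<psi> x - \<psi> y) < e"
        using \<psi> x \<open>e > 0\<close> unfolding C_Zp_iff by meson
      obtain m where m: "absv (x - of_nat m) < min d1 d2"
        using Z_p_approx_nat[OF x, of "min d1 d2"] d1(1) d2(1) by auto
      have "absv ((\<phi> x - \<phi> (of_nat m)) - (\<psi> x - \<psi> (of_nat m))) < e"
        using absv_diff_less[OF d1(2) d2(2), OF of_nat_Z_p _ of_nat_Z_p] m by simp
      then show ?thesis
        by (simp add: nat)
    qed
    then have "absv (\<phi> x - \<psi> x) \<le> 0"
      by (rule field_le_epsilon)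
    then show "\<phi> x = \<psi> x"
      using absv_pos[of "\<phi> x - \<psi> x"] by force
  qed (use \<phi> \<psi> in \<open>auto simp: C_Zp_def\<close>)
qed

text \<open>By the absorption identity \<open>x * (x - 1 gchoose n) = (n + 1) * (x gchoose (n + 1))\<close>, the
  series of \<open>x * \<phi> (x - 1)\<close> is that of \<open>\<phi>\<close> with \<open>a\<close> shifted by one.\<close>

lemma S_op_mahler_sums:
  assumes a: "(\<lambda>n. absv (fact n * a n)) \<longlonglongrightarrow> 0" and \<phi>: "mahler_sums absv (\<lambda>n. fact n * a n) \<phi>"
    and x: "x \<in> Z_p absv"
  shows "abs_sums absv (\<lambda>n. fact n * (a n - (if n = 0 then 0 else a (n - 1))) * (x gchoose n))
    (S_op absv \<phi> x)"
proof -
  define d where "d n = fact n * (if n = 0 then 0 else a (n - 1)) * (x gchoose n)" for n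
  have sums: "abs_sums absv (\<lambda>n. fact n * a n * (y gchoose n)) (\<phi> y)" if "y \<in> Z_p absv" for y
    using \<phi> that by (simp add: mahler_sums_iff_abs_sums[OF a])
  have "abs_sums absv (\<lambda>n. x * (fact n * a n * (x - 1 gchoose n))) (x * \<phi> (x - 1))"
    by (intro abs_sums_mult sums Z_p_diff x Z_p_1)
  moreover have "x * (fact n * a n * (x - 1 gchoose n)) = d (Suc n)" for n
  proof -
    have "x * (fact n * a n * (x - 1 gchoose n)) = fact n * a n * (x * (x - 1 gchoose n))"
      by (simp add: algebra_simps)
    also have "\<dots> = d (Suc n)"
      unfolding gbinomial_absorption[symmetric] by (simp add: d_def algebra_simps)
    finally show ?thesis .
  qed
  ultimately have "abs_sums absv (\<lambda>n. d (Suc n)) (x * \<phi> (x - 1))"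
    by simp
  then have "abs_sums absv d (d 0 + x * \<phi> (x - 1))"
    by (rule abs_sums_Suc_imp)
  then have "abs_sums absv d (x * \<phi> (x - 1))"
    by (simp add: d_def)
  from abs_sums_diff[OF sums[OF x] this] show ?thesis
    using x by (simp add: d_def S_op_def algebra_simps)
qed

text \<open>Pascal's rule splits \<open>x + 1 gchoose n\<close> into \<open>x gchoose n\<close> and \<open>x gchoose (n - 1)\<close>; the
  second summand shifts the coefficients down by one.\<close>

lemma sigma_op_mahler_sums:
  assumes c: "(\<lambda>n. absv (c n)) \<longlonglongrightarrow> 0" and \<phi>: "mahler_sums absv c \<phi>" and x: "x \<in> Z_p absv"
  shows "abs_sums absv (\<lambda>n. (c n + c (Suc n)) * (x gchoose n)) (sigma_op absv \<phi> x)"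
proof -
  define d where "d n = (if n = 0 then 0 else c n * (x gchoose (n - 1)))" for n
  have c_Suc: "(\<lambda>n. absv (c (Suc n))) \<longlonglongrightarrow> 0"
    using c by (rule LIMSEQ_Suc)
  have sums: "abs_sums absv (\<lambda>n. c n * (y gchoose n)) (\<phi> y)" if "y \<in> Z_p absv" for y
    using \<phi> that by (simp add: mahler_sums_iff_abs_sums[OF c])
  obtain t where t: "abs_sums absv (\<lambda>n. c (Suc n) * (x gchoose n)) t"
    using Z_p_abs_sums_exists[OF c_Suc x] by blast
  have d_0: "d 0 = 0"
    by (simp add: d_def)
  have "abs_sums absv d (d 0 + t)"
    using t by (intro abs_sums_Suc_imp) (simp add: d_def)
  then have "abs_sums absv (\<lambda>n. c n * (x gchoose n) + d n) (\<phi> x + t)"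
    using abs_sums_add[OF sums[OF x]] d_0 by simp
  moreover have "c n * (x gchoose n) + d n = c n * (x + 1 gchoose n)" for n
  proof (cases n)
    case (Suc m)
    have "c n * (x gchoose n) + d n = c n * ((x gchoose m) + (x gchoose Suc m))"
      unfolding d_def Suc by (simp add: algebra_simps)
    then show ?thesis
      unfolding Suc gbinomial_Suc_Suc .
  qed (simp add: d_def)
  ultimately have "abs_sums absv (\<lambda>n. c n * (x + 1 gchoose n)) (\<phi> x + t)"
    by simp
  then have "\<phi> (x + 1) = \<phi> x + t"
    using abs_sums_unique sums[OF Z_p_add[OF x Z_p_1]] by blast
  moreover have "abs_sums absv (\<lambda>n. c n * (x gchoose n) + c (Suc n) * (x gchoose n)) (\<phi> x + t)"
    by (intro abs_sums_add sums x t)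
  ultimately show ?thesis
    using x by (simp add: sigma_op_def algebra_simps)
qed

lemma J_series_inverse_operators:
  assumes F: "\<And>n. absv (F $ n) \<le> M"
    and \<psi>: "\<psi> \<in> C_Zp absv" "mahler_sums absv (\<lambda>n. fact n * (fps_deriv F + F) $ n) \<psi>"
  shows "J_series absv (inv_into (C_Zp absv) (S_op absv)
    (inv_into (C_Zp absv) (sigma_op absv) \<psi>)) = F"
proof -
  \<comment> \<open>The Mahler coefficients forced by \<open>J \<phi> = F\<close>; they satisfy the same bound as \<open>F\<close>.\<close>
  define a where "a n = (\<Sum>i\<le>n. F $ i)" for n
  have a_diff: "a n - (if n = 0 then 0 else a (n - 1)) = F $ n" for n
    by (cases n) (simp_all add: a_def)
  have "0 \<le> M"
    using F[of 0] absv_nonneg[of "F $ 0"] by linarith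
  then have "absv (a n) \<le> M" for n
    unfolding a_def by (intro absv_sum_le F)
  then have a: "(\<lambda>n. absv (fact n * a n)) \<longlonglongrightarrow> 0"
    by (rule absv_fact_mult_tendsto_0)
  have f: "(\<lambda>n. absv (fact n * F $ n)) \<longlonglongrightarrow> 0"
    by (rule absv_fact_mult_tendsto_0[OF F])
  have g: "fact n * (fps_deriv F + F) $ n = fact n * F $ n + fact (Suc n) * F $ Suc n" for n
    by (simp add: algebra_simps)
  have g_lim: "(\<lambda>n. absv (fact n * (fps_deriv F + F) $ n)) \<longlonglongrightarrow> 0"
  proof (rule absv_fact_mult_tendsto_0)
    show "absv ((fps_deriv F + F) $ n) \<le> M" for n
      using absv_mult_le[OF absv_of_nat_le_1 F, of "n + 1" "n + 1"] F
      by (simp add: absv_add_le del: of_nat_Suc of_nat_add)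
  qed
  obtain \<phi> where \<phi>: "\<phi> \<in> C_Zp absv" "mahler_sums absv (\<lambda>n. fact n * a n) \<phi>"
    using mahler_sums_exists[OF a] by blast
  obtain \<chi> where \<chi>: "\<chi> \<in> C_Zp absv" "mahler_sums absv (\<lambda>n. fact n * F $ n) \<chi>"
    using mahler_sums_exists[OF f] by blast
  have "mahler_sums absv (\<lambda>n. fact n * F $ n) (S_op absv \<phi>)"
    using S_op_mahler_sums[OF a \<phi>(2)] unfolding a_diff mahler_sums_iff_abs_sums[OF f] by blast
  then have S: "S_op absv \<phi> = \<chi>"
    using \<chi> by (intro mahler_sums_unique[OF f]) (auto simp: C_Zp_def S_op_def)
  have "mahler_sums absv (\<lambda>n. fact n * (fps_deriv F + F) $ n) (sigma_op absv \<chi>)"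
    using sigma_op_mahler_sums[OF f \<chi>(2)]
    unfolding mahler_sums_iff_abs_sums[OF g_lim] unfolding g by blast
  then have \<sigma>: "sigma_op absv \<chi> = \<psi>"
    using \<psi> by (intro mahler_sums_unique[OF g_lim]) (auto simp: C_Zp_def sigma_op_def)
  have "inv_into (C_Zp absv) (S_op absv) (inv_into (C_Zp absv) (sigma_op absv) \<psi>) = \<phi>"
    using inv_into_f_f[OF inj_on_S_op \<phi>(1)] inv_into_f_f[OF inj_on_sigma_op \<chi>(1)] S \<sigma> by simp
  moreover have "J_series absv \<phi> = F"
    unfolding J_series_def mahler_coeff_eqI[OF a \<phi>(2)] a_diff by (simp add: fps_nth_inverse)
  ultimately show ?thesis
    by simp
qed

end

section \<open>The operator \<open>F \<mapsto> F' + F\<close> over a complete subfield\<close>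

locale complete_padic_subfield = padic_complex_field p absv
  for p and absv :: "'c::field_char_0 \<Rightarrow> real" +
  fixes K :: "'c set"
  assumes subfield_K: "subfield K ring_of_type_algebra"
    and complete_K: "Metric_space.mcomplete K (abs_dist absv)"
begin

lemma K_subring:
  shows K_0: "0 \<in> K" and K_1: "1 \<in> K"
    and K_add: "x \<in> K \<Longrightarrow> y \<in> K \<Longrightarrow> x + y \<in> K"
    and K_mult: "x \<in> K \<Longrightarrow> y \<in> K \<Longrightarrow> x * y \<in> K"
    and K_minus: "x \<in> K \<Longrightarrow> - x \<in> K"
proof -
  interpret R: ring "ring_of_type_algebra :: 'c ring"
    by (rule ring_from_type_algebra)
  have sub: "subring K ring_of_type_algebra"
    using subfield_K by (simp add: subfield_def subdomain_def subcring_def)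
  note K = subringE[OF sub]
  show "0 \<in> K" "1 \<in> K" "x \<in> K \<Longrightarrow> y \<in> K \<Longrightarrow> x + y \<in> K" "x \<in> K \<Longrightarrow> y \<in> K \<Longrightarrow> x * y \<in> K"
    using K(2,3) K(6,7)[of x y] by (simp_all add: ring_of_type_algebra_def)
  have "\<ominus>\<^bsub>ring_of_type_algebra\<^esub> x = - x"
    by (rule R.minus_equality) (auto simp: ring_of_type_algebra_def)
  then show "x \<in> K \<Longrightarrow> - x \<in> K"
    using K(5)[of x] by simp
qed

lemma K_of_nat: "of_nat n \<in> K"
  by (induction n) (auto intro: K_0 K_1 K_add)

lemma K_minus_1_power: "(- 1) ^ n \<in> K"
  by (induction n) (auto intro: K_1 K_minus)

lemma fps_le_0: "0 < M \<Longrightarrow> 0 \<in> fps_le absv K M"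
  by (simp add: fps_le_def K_0)

lemma fps_le_add: "F \<in> fps_le absv K M \<Longrightarrow> G \<in> fps_le absv K M \<Longrightarrow> F + G \<in> fps_le absv K M"
  by (auto simp: fps_le_def intro: K_add absv_add_le)

lemma fps_le_smult:
  "a \<in> K \<Longrightarrow> absv a \<le> 1 \<Longrightarrow> F \<in> fps_le absv K M \<Longrightarrow> fps_const a * F \<in> fps_le absv K M"
  by (auto simp: fps_le_def intro: K_mult absv_mult_le)

lemma fps_le_mono: "M \<le> N \<Longrightarrow> fps_le absv K M \<subseteq> fps_le absv K N"
  by (auto simp: fps_le_def intro: order_trans)

lemma fps_le_deriv: "F \<in> fps_le absv K M \<Longrightarrow> fps_deriv F \<in> fps_le absv K M"
  by (auto simp: fps_le_def K_mult K_of_nat absv_mult_le absv_of_nat_le_1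
      simp del: of_nat_Suc of_nat_add)

text \<open>The equation gives \<open>n! f n = (-1)^n f 0\<close>. The left-hand side tends to 0, the right-hand
  side has constant absolute value.\<close>

lemma fps_deriv_add_self_eq_0_imp:
  assumes F: "F \<in> fps_le absv K M" and eq: "fps_deriv F + F = 0"
  shows "F = 0"
proof -
  have step: "of_nat (Suc n) * F $ Suc n = - F $ n" for n
    using arg_cong[OF eq, of "\<lambda>F. F $ n"] by (simp add: eq_neg_iff_add_eq_0 del: of_nat_Suc)
  have fact_mult: "fact n * F $ n = (- 1) ^ n * F $ 0" for n
  proof (induction n)
    case (Suc n)
    have "fact (Suc n) * F $ Suc n = fact n * (of_nat (Suc n) * F $ Suc n)"
      by (simp add: algebra_simps)
    also have "\<dots> = - (fact n * F $ n)"
      unfolding step by simp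
    finally show ?case
      by (simp add: Suc)
  qed simp
  have "(\<lambda>n. absv (fact n * F $ n)) \<longlonglongrightarrow> 0"
    using F by (intro absv_fact_mult_tendsto_0[of _ M]) (simp add: fps_le_def)
  then have "(\<lambda>n::nat. absv (F $ 0)) \<longlonglongrightarrow> 0"
    by (simp add: fact_mult absv_mult absv_power)
  then have "F $ 0 = 0"
    by (simp add: LIMSEQ_const_iff absv_eq_0_iff)
  then have "fact n * F $ n = 0" for n
    by (simp add: fact_mult)
  then show ?thesis
    by (simp add: fps_eq_iff)
qed

text \<open>The solution is \<open>f n = (\<Sum>k. (-1)^k (n+k)!/n! b (n+k))\<close>. Writing the quotient of
  factorials as \<open>k! * ((n+k) choose k)\<close> shows that the terms tend to 0, satisfy the bound of
  \<open>G\<close>, and lie in \<open>K\<close>. The recursion \<open>f n = b n - (n+1) f (n+1)\<close> comes from splitting off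
  the term \<open>k = 0\<close>.\<close>

lemma fps_deriv_add_self_solvable:
  assumes G: "G \<in> fps_le absv K M"
  shows "\<exists>F\<in>fps_le absv K M. fps_deriv F + F = G"
proof -
  define e where "e n k = of_nat ((n + k) choose k) * G $ (n + k)" for n k
  define c where "c n k = (- 1) ^ k * (fact k * e n k)" for n k
  have "0 \<le> M"
    using G absv_nonneg[of "G $ 0"] by (force simp: fps_le_def intro: order_trans)
  have e: "absv (e n k) \<le> M" "e n k \<in> K" for n k
    using G by (auto simp: fps_le_def e_def intro!: absv_mult_le absv_of_nat_le_1 K_mult K_of_nat)
  have absv_c: "absv (c n k) = absv (fact k * e n k)" for n k
    by (simp add: c_def absv_mult absv_power)
  have fact_K: "fact k \<in> K" for k
    using K_of_nat[of "fact k"] by simp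
  have c: "(\<lambda>k. absv (c n k)) \<longlonglongrightarrow> 0" "c n k \<in> K" "absv (c n k) \<le> M" for n k
  proof -
    show "(\<lambda>k. absv (c n k)) \<longlonglongrightarrow> 0"
      unfolding absv_c by (rule absv_fact_mult_tendsto_0[OF e(1)])
    show "c n k \<in> K"
      unfolding c_def by (intro K_mult K_minus_1_power fact_K e)
    show "absv (c n k) \<le> M"
      unfolding absv_c using absv_mult_le[OF absv_of_nat_le_1[of "fact k"] e(1)] by simp
  qed
  have "\<forall>n. \<exists>s. s \<in> K \<and> abs_sums absv (c n) s"
    using abs_sums_exists[OF complete_K K_0 K_add c(2,1)] by blast
  then obtain f where f: "\<And>n. f n \<in> K" "\<And>n. abs_sums absv (c n) (f n)"
    by metis
  have f_le: "absv (f n) \<le> M" for n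
    using abs_sums_tail_le[OF f(2) \<open>0 \<le> M\<close>, of 0] c(3) by simp
  have rec: "f n = G $ n - of_nat (Suc n) * f (Suc n)" for n
  proof -
    have "c n (Suc k) = - of_nat (Suc n) * c (Suc n) k" for k
    proof -
      have "Suc k * ((n + Suc k) choose Suc k) = Suc n * ((Suc n + k) choose k)"
        using Suc_times_binomial_add[of k n] by (simp add: add.commute)
      then have eq: "of_nat (Suc k) * of_nat ((n + Suc k) choose Suc k)
          = (of_nat (Suc n) * of_nat ((Suc n + k) choose k) :: 'c)"
        by (metis of_nat_mult)
      have "c n (Suc k) = - ((- 1) ^ k * (fact k
          * (of_nat (Suc k) * of_nat ((n + Suc k) choose Suc k) * G $ (n + Suc k))))"
        by (simp add: c_def e_def mult_ac del: of_nat_Suc binomial_Suc_Suc)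
      then show ?thesis
        unfolding eq by (simp add: c_def e_def mult_ac del: of_nat_Suc binomial_Suc_Suc)
    qed
    then have "abs_sums absv (\<lambda>k. c n (Suc k)) (- of_nat (Suc n) * f (Suc n))"
      using abs_sums_mult[OF f(2)[of "Suc n"], of "- of_nat (Suc n)"] by simp
    then have "abs_sums absv (c n) (c n 0 + - of_nat (Suc n) * f (Suc n))"
      by (rule abs_sums_Suc_imp)
    then have "f n = c n 0 + - of_nat (Suc n) * f (Suc n)"
      by (rule abs_sums_unique[OF f(2)])
    then show ?thesis
      by (simp add: c_def e_def del: of_nat_Suc)
  qed
  have "fps_deriv (Abs_fps f) + Abs_fps f = G"
  proof (rule fps_ext)
    fix n
    show "(fps_deriv (Abs_fps f) + Abs_fps f) $ n = G $ n"
      using rec[of n] by simp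
  qed
  moreover have "Abs_fps f \<in> fps_le absv K M"
    by (simp add: fps_le_def f(1) f_le)
  ultimately show ?thesis
    by blast
qed

lemma cring_unit_ball_ring: "cring (unit_ball_ring absv K)"
proof (intro cringI abelian_groupI comm_monoidI)
  fix x
  assume "x \<in> carrier (unit_ball_ring absv K)"
  then show "\<exists>y\<in>carrier (unit_ball_ring absv K).
      y \<oplus>\<^bsub>unit_ball_ring absv K\<^esub> x = \<zero>\<^bsub>unit_ball_ring absv K\<^esub>"
    by (intro bexI[of _ "- x"]) (auto simp: unit_ball_ring_def ring_of_type_algebra_def K_minus)
qed (auto simp: unit_ball_ring_def ring_of_type_algebra_def algebra_simps K_0 K_1 K_add K_mult
    absv_add_le absv_mult_le)

end

locale bounded_fps_space = complete_padic_subfield p absv K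
  for p and absv :: "'c::field_char_0 \<Rightarrow> real" and K +
  fixes W :: "'c fps set"
  assumes W: "(\<exists>M>0. W = fps_le absv K M) \<or> W = fps_bounded absv K"
begin

text \<open>This treats both kinds of \<open>W\<close> alike: any two elements lie in a common
  \<open>fps_le absv K M\<close> inside \<open>W\<close>, so every property reduces to a fixed bound \<open>M\<close>.\<close>

lemma W_bounded:
  assumes "F \<in> W" "G \<in> W"
  obtains M where "M > 0" "F \<in> fps_le absv K M" "G \<in> fps_le absv K M" "fps_le absv K M \<subseteq> W"
proof (cases "W = fps_bounded absv K")
  case True
  then obtain M N where "M > 0" "F \<in> fps_le absv K M" "N > 0" "G \<in> fps_le absv K N"
    using assms by (auto simp: fps_bounded_def)
  then have "max M N > 0" "F \<in> fps_le absv K (max M N)" "G \<in> fps_le absv K (max M N)"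
    using fps_le_mono[of M "max M N"] fps_le_mono[of N "max M N"] by auto
  moreover from this have "fps_le absv K (max M N) \<subseteq> W"
    unfolding True fps_bounded_def by blast
  ultimately show ?thesis
    by (rule that)
next
  case False
  then show ?thesis
    using W assms that by blast
qed

lemma W_0: "0 \<in> W"
  using W fps_le_0 zero_less_one unfolding fps_bounded_def by blast

lemma W_add: "F \<in> W \<Longrightarrow> G \<in> W \<Longrightarrow> F + G \<in> W"
  by (meson W_bounded fps_le_add subsetD)

lemma W_smult: "a \<in> K \<Longrightarrow> absv a \<le> 1 \<Longrightarrow> F \<in> W \<Longrightarrow> fps_const a * F \<in> W"
  by (meson W_bounded fps_le_smult subsetD)

lemma W_minus: "F \<in> W \<Longrightarrow> - F \<in> W"
  using W_smult[of "-1" F] K_minus[OF K_1] by (simp flip: fps_const_neg)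

lemma fps_deriv_add_self_W: "F \<in> W \<Longrightarrow> fps_deriv F + F \<in> W"
  by (meson W_bounded fps_le_add fps_le_deriv subsetD)

lemma bij_betw_fps_deriv_add_self: "bij_betw (\<lambda>F. fps_deriv F + F) W W"
proof (rule bij_betw_imageI)
  show "inj_on (\<lambda>F. fps_deriv F + F) W"
  proof (rule inj_onI)
    fix F G
    assume FG: "F \<in> W" "G \<in> W" and eq: "fps_deriv F + F = fps_deriv G + G"
    have "F - G \<in> W"
      using W_add[OF FG(1) W_minus[OF FG(2)]] by simp
    then obtain M where "F - G \<in> fps_le absv K M"
      using W_bounded by blast
    moreover have "fps_deriv (F - G) + (F - G) = 0"
      using eq by (simp add: algebra_simps)
    ultimately have "F - G = 0"
      by (rule fps_deriv_add_self_eq_0_imp)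
    then show "F = G"
      by simp
  qed
  have "G \<in> (\<lambda>F. fps_deriv F + F) ` W" if G: "G \<in> W" for G
  proof -
    obtain M where M: "G \<in> fps_le absv K M" "fps_le absv K M \<subseteq> W"
      using W_bounded[OF G G] by blast
    then show ?thesis
      using fps_deriv_add_self_solvable[OF M(1)] by blast
  qed
  then show "(\<lambda>F. fps_deriv F + F) ` W = W"
    using fps_deriv_add_self_W by blast
qed

lemma module_fps_module: "Module.module (unit_ball_ring absv K) (fps_module W)"
proof (intro Module.moduleI cring_unit_ball_ring abelian_groupI)
  fix F
  assume "F \<in> carrier (fps_module W)"
  then show "\<exists>G\<in>carrier (fps_module W). G \<oplus>\<^bsub>fps_module W\<^esub> F = \<zero>\<^bsub>fps_module W\<^esub>"
    by (intro bexI[of _ "- F"]) (auto simp: fps_module_def W_minus)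
qed (auto simp: fps_module_def unit_ball_ring_def ring_of_type_algebra_def W_0 W_add W_smult
    add_ac distrib_left distrib_right mult.assoc simp flip: fps_const_add fps_const_mult)

lemma module_automorphism_fps_deriv_add_self:
  "module_automorphism (unit_ball_ring absv K) (fps_module W) (\<lambda>F. fps_deriv F + F)"
  using module_fps_module bij_betw_fps_deriv_add_self fps_deriv_add_self_W
  by (auto simp: module_automorphism_def iso_def hom_def fps_module_def algebra_simps)

end

theorem proposition7p3:
  fixes p :: nat and absv :: "'c::field_char_0 \<Rightarrow> real"
    and K :: "'c set" and W :: "'c fps set"
  assumes "padic_complex_field p absv"
    and "subfield K ring_of_type_algebra"
    and "Metric_space.mcomplete K (abs_dist absv)"
    and "(\<exists>M>0. W = fps_le absv K M) \<or> W = fps_bounded absv K"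
  shows "module_automorphism (unit_ball_ring absv K) (fps_module W) (\<lambda>F. fps_deriv F + F) \<and>
    module_automorphism (unit_ball_ring absv K)
      (fps_module {F. \<forall>n. fps_nth F n \<in> carrier (unit_ball_ring absv K)})
      (\<lambda>F. fps_deriv F + F) \<and>
    (\<forall>G\<in>W.
      (\<exists>\<psi>\<in>C_Zp absv. mahler_sums absv (\<lambda>n. fact n * fps_nth G n) \<psi>) \<and>
      (\<forall>\<psi>\<in>C_Zp absv. mahler_sums absv (\<lambda>n. fact n * fps_nth G n) \<psi> \<longrightarrow>
        (let \<phi> = (inv_into (C_Zp absv) (S_op absv) \<circ> inv_into (C_Zp absv) (sigma_op absv)) \<psi>
         in J_series absv \<phi> \<in> W \<and>
            (\<forall>F\<in>W. fps_deriv F + F = G \<longleftrightarrow> F = J_series absv \<phi>))))"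
proof -
  interpret padic_complex_field p absv
    by (rule assms(1))
  interpret complete_padic_subfield p absv K
    by (intro complete_padic_subfield.intro complete_padic_subfield_axioms.intro assms)
  interpret bounded_fps_space p absv K W
    by (intro bounded_fps_space.intro bounded_fps_space_axioms.intro
        complete_padic_subfield_axioms assms(4))
  interpret unit: bounded_fps_space p absv K "fps_le absv K 1"
    by (intro bounded_fps_space.intro bounded_fps_space_axioms.intro
        complete_padic_subfield_axioms) (auto intro: zero_less_one)
  \<comment> \<open>The power series over the unit ball are those of bound \<open>M = 1\<close>.\<close>
  have unit_ball: "{F. \<forall>n. fps_nth F n \<in> carrier (unit_ball_ring absv K)} = fps_le absv K 1"
    by (simp add: fps_le_def unit_ball_ring_def)
  have "(\<exists>\<psi>\<in>C_Zp absv. mahler_sums absv (\<lambda>n. fact n * fps_nth G n) \<psi>) \<and>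
      (\<forall>\<psi>\<in>C_Zp absv. mahler_sums absv (\<lambda>n. fact n * fps_nth G n) \<psi> \<longrightarrow>
        (let \<phi> = (inv_into (C_Zp absv) (S_op absv) \<circ> inv_into (C_Zp absv) (sigma_op absv)) \<psi>
         in J_series absv \<phi> \<in> W \<and>
            (\<forall>F\<in>W. fps_deriv F + F = G \<longleftrightarrow> F = J_series absv \<phi>)))" if G: "G \<in> W" for G
  proof -
    obtain M where "G \<in> fps_le absv K M"
      using W_bounded[OF G G] by blast
    then have "\<And>n. absv (fps_nth G n) \<le> M"
      by (simp add: fps_le_def)
    then have exists: "\<exists>\<psi>\<in>C_Zp absv. mahler_sums absv (\<lambda>n. fact n * fps_nth G n) \<psi>"
      by (intro mahler_sums_exists absv_fact_mult_tendsto_0)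
    have "G \<in> (\<lambda>F. fps_deriv F + F) ` W"
      using G by (simp add: bij_betw_imp_surj_on[OF bij_betw_fps_deriv_add_self])
    then obtain F where F: "F \<in> W" "fps_deriv F + F = G"
      by force
    obtain N where "F \<in> fps_le absv K N"
      using W_bounded[OF F(1) F(1)] by blast
    then have N: "\<And>n. absv (fps_nth F n) \<le> N"
      by (simp add: fps_le_def)
    have unique: "F' = F" if "F' \<in> W" "fps_deriv F' + F' = G" for F'
      by (rule inj_onD[OF bij_betw_imp_inj_on[OF bij_betw_fps_deriv_add_self]])
        (simp_all only: that F)
    have "let \<phi> = (inv_into (C_Zp absv) (S_op absv) \<circ> inv_into (C_Zp absv) (sigma_op absv)) \<psi>
         in J_series absv \<phi> \<in> W \<and> (\<forall>F\<in>W. fps_deriv F + F = G \<longleftrightarrow> F = J_series absv \<phi>)"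
      if \<psi>: "\<psi> \<in> C_Zp absv" "mahler_sums absv (\<lambda>n. fact n * fps_nth G n) \<psi>" for \<psi>
    proof -
      have J: "J_series absv (inv_into (C_Zp absv) (S_op absv)
          (inv_into (C_Zp absv) (sigma_op absv) \<psi>)) = F"
        using J_series_inverse_operators[OF N \<psi>(1)] \<psi>(2) unfolding F(2) .
      show ?thesis
        unfolding Let_def o_apply J using F unique by blast
    qed
    with exists show ?thesis
      by blast
  qed
  then show ?thesis
    using module_automorphism_fps_deriv_add_self unit.module_automorphism_fps_deriv_add_self
    unfolding unit_ball by blast
qed

end
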